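(* Let $n>1$ and let $d=(d_1,\ldots,d_n)$ be a non-increasing sequence of strictly positive integers, $d_1\geq\cdots\geq d_n>0$, such that $\sum_{i=1}^n d_i$ is even. Then the number $C((d_1,\ldots,d_n))$ of labeled graphs that realize $(d_1,\ldots,d_n)$ satisfies the recurrence relation $$C((d_1,\ldots,d_n)) = \sum_{S\in\binom{\{1,\ldots,n-1\}}{d_n}} C\bigl((d_1,\ldots,d_{n-1})/ S\bigr),$$ where $\binom{X}{k}$ denotes the set of all subsets of size $k$ of a set $X$.
   Context: All graphs are simple, labeled and undirected. For a finite non-increasing sequence of strictly positive integers $d=(d_1,\ldots,d_n)$, a labeled graph realizes $d$ if its vertex set is the fixed set of $n$ distinct vertices $\{x_1,\ldots,x_n\}$ and $\deg(x_i)=d_i$ for every $i=1,\ldots,n$ (so the $i$-th vertex has the prescribed degree $d_i$). $C(d)$ denotes the number of graphs on $\{x_1,\ldots,x_n\}$ that realize $d$ (it is $0$ if there are none). For the empty sequence $\epsilon$ one has $C(\epsilon)=1$ (the empty graph). For a subset $S\subseteq\{1,\ldots,n-1\}$ with characteristic function $\chi_S$, the notation $(d_1,\ldots,d_{n-1})/S$ stands for the sequence obtained from $(d_1-\chi_S(1),\ldots,d_{n-1}-\chi_S(n-1))$ by reordering it in non-increasing order and removing all entries equal to $0$ (the result may be the empty sequence $\epsilon$). *)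

theory Defs
  imports Main
begin

text \<open>
  The vertices \<open>x\<^sub>1, \<dots>, x\<^sub>n\<close> are the numbers \<open>1, \<dots>, n\<close>. A simple undirected graph on a
  fixed vertex set is its set of edges, each edge being a two-element set of vertices.
\<close>

definition simple_graph_on :: "'v set \<Rightarrow> 'v set set \<Rightarrow> bool" where
  "simple_graph_on V E \<longleftrightarrow> (\<forall>e\<in>E. e \<subseteq> V \<and> card e = 2)"

definition degree :: "'v set set \<Rightarrow> 'v \<Rightarrow> nat" where
  "degree E v = card {e \<in> E. v \<in> e}"

text \<open>
  The list \<open>d\<close> is the sequence \<open>(d\<^sub>1, \<dots>, d\<^sub>n)\<close>. Since list indices start at 0, \<open>d\<^sub>i\<close> is
  \<open>d ! (i - 1)\<close>.
\<close>

definition realizes :: "nat set set \<Rightarrow> nat list \<Rightarrow> bool" where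
  "realizes E d \<longleftrightarrow> simple_graph_on {1..length d} E
     \<and> (\<forall>i\<in>{1..length d}. degree E i = d ! (i - 1))"

definition num_realizations :: "nat list \<Rightarrow> nat" where
  "num_realizations d = card {E. realizes E d}"

text \<open>
  The sequence \<open>d / S\<close>. It is only used for positive entries, so that the truncated
  subtraction on natural numbers is the usual one.
\<close>

definition reduce_seq :: "nat list \<Rightarrow> nat set \<Rightarrow> nat list" where
  "reduce_seq d S =
     filter (\<lambda>x. x \<noteq> 0)
       (rev (sort (map (\<lambda>i. d ! (i - 1) - (if i \<in> S then 1 else 0)) [1..<length d + 1])))"

end

theory Submission
  imports Defs "HOL-Combinatorics.List_Permutation"
begin

text \<open>
  A graph on \<open>V \<union> {x}\<close> is the same thing as a set \<open>S \<subseteq> V\<close>, the neighbourhood of \<open>x\<close>, together with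
  a graph \<open>F\<close> on \<open>V\<close>, what is left when \<open>x\<close> is deleted. The degree of \<open>x\<close> is then \<open>card S\<close>, and
  the deletion of \<open>x\<close> lowers the degree of exactly the vertices in \<open>S\<close> by one. So the realizations
  of a degree function \<open>f\<close> on \<open>V \<union> {x}\<close> correspond to the pairs \<open>(S, F)\<close> in which \<open>S\<close> has \<open>f x\<close>
  elements and \<open>F\<close> realizes \<open>f - \<chi>\<^sub>S\<close> on \<open>V\<close>; this is \<open>card_graphs_with_degrees_insert\<close>, and it is
  the recurrence up to the normalization of the sequence \<open>f - \<chi>\<^sub>S\<close>.

  The normalization does not change the number of graphs. Sorting only renames the vertices
  (\<open>card_graphs_with_degrees_bij\<close>), and removing zeros only discards isolated vertices, which
  does not even change the set of graphs, as a graph is identified with its set of edges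
  (\<open>graphs_with_degrees_nonzero\<close>). Both steps need vertex sets other than \<open>{1..n}\<close>, which is why
  the counting is done for degree functions on arbitrary finite sets.
\<close>

section \<open>Graphs with a prescribed degree function\<close>

definition graphs_with_degrees :: "'v set \<Rightarrow> ('v \<Rightarrow> nat) \<Rightarrow> 'v set set set" where
  "graphs_with_degrees V f = {E. simple_graph_on V E \<and> (\<forall>v\<in>V. degree E v = f v)}"

lemma num_realizations_eq:
  "num_realizations d = card (graphs_with_degrees {1..length d} (\<lambda>i. d ! (i - 1)))"
  by (simp add: num_realizations_def realizes_def graphs_with_degrees_def)

lemma finite_simple_graph: "finite V \<Longrightarrow> simple_graph_on V E \<Longrightarrow> finite E"
  by (rule finite_subset[of E "Pow V"]) (auto simp: simple_graph_on_def)

lemma finite_graphs_with_degrees: "finite V \<Longrightarrow> finite (graphs_with_degrees V f)"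
  by (rule finite_subset[of _ "Pow (Pow V)"])
     (auto simp: graphs_with_degrees_def simple_graph_on_def)

lemma graphs_with_degrees_cong:
  "(\<And>v. v \<in> V \<Longrightarrow> f v = g v) \<Longrightarrow> graphs_with_degrees V f = graphs_with_degrees V g"
  by (auto simp: graphs_with_degrees_def)

lemma image_graphs_with_degrees:
  assumes p: "inj_on p V" and fg: "\<And>v. v \<in> V \<Longrightarrow> f v = g (p v)"
    and E: "E \<in> graphs_with_degrees V f"
  shows "(`) p ` E \<in> graphs_with_degrees (p ` V) g"
proof -
  have sg: "e \<subseteq> V" "card e = 2" if "e \<in> E" for e
    using E that by (auto simp: graphs_with_degrees_def simple_graph_on_def)
  have "degree ((`) p ` E) (p v) = g (p v)" if v: "v \<in> V" for v
  proof -
    have "p v \<in> p ` e \<longleftrightarrow> v \<in> e" if "e \<in> E" for e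
      using inj_on_image_mem_iff[OF p v sg(1)[OF that]] .
    then have "{e \<in> (`) p ` E. p v \<in> e} = (`) p ` {e \<in> E. v \<in> e}"
      by blast
    moreover have "inj_on ((`) p) {e \<in> E. v \<in> e}"
      by (rule inj_on_subset[OF inj_on_image_Pow[OF p]]) (use sg in auto)
    ultimately have "degree ((`) p ` E) (p v) = degree E v"
      by (simp add: degree_def card_image)
    then show ?thesis using E v fg by (simp add: graphs_with_degrees_def)
  qed
  moreover have "simple_graph_on (p ` V) ((`) p ` E)"
    using sg by (auto simp: simple_graph_on_def card_image[OF inj_on_subset[OF p]])
  ultimately show ?thesis by (auto simp: graphs_with_degrees_def)
qed

text \<open>Renaming the vertices along a bijection turns the realizations of one degree function into
  those of the other, and renaming back undoes it.\<close>

lemma card_graphs_with_degrees_bij: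
  assumes p: "bij_betw p V W" and fg: "\<And>v. v \<in> V \<Longrightarrow> f v = g (p v)"
  shows "card (graphs_with_degrees V f) = card (graphs_with_degrees W g)"
proof (rule bij_betw_same_card, rule bij_betw_byWitness)
  define q where "q = inv_into V p"
  have inj: "inj_on p V" and W: "p ` V = W" using p by (auto simp: bij_betw_def)
  have q: "bij_betw q W V" using p by (simp add: q_def bij_betw_inv_into)
  then have injq: "inj_on q W" and V: "q ` W = V" by (auto simp: bij_betw_def)
  have qp: "q (p v) = v" if "v \<in> V" for v using that p by (simp add: q_def bij_betw_inv_into_left)
  have pq: "p (q w) = w" if "w \<in> W" for w using that p by (simp add: q_def bij_betw_inv_into_right)
  have gf: "g w = f (q w)" if "w \<in> W" for w
    using that fg[of "q w"] V pq by auto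
  have id_image: "(`) r ` (`) s ` E = E"
    if "\<And>u. u \<in> U \<Longrightarrow> r (s u) = u" "\<And>e. e \<in> E \<Longrightarrow> e \<subseteq> U" for r s U and E :: "'c set set"
  proof -
    have "r ` s ` e = e" if "e \<in> E" for e
      using \<open>\<And>u. u \<in> U \<Longrightarrow> r (s u) = u\<close> \<open>\<And>e. e \<in> E \<Longrightarrow> e \<subseteq> U\<close>[OF that]
      by (force simp: image_image)
    then show ?thesis by (simp add: image_image)
  qed
  show "\<forall>E\<in>graphs_with_degrees V f. (`) q ` (`) p ` E = E"
    using id_image[of V q p, OF qp] by (auto simp: graphs_with_degrees_def simple_graph_on_def)
  show "\<forall>E\<in>graphs_with_degrees W g. (`) p ` (`) q ` E = E"
    using id_image[of W p q, OF pq] by (auto simp: graphs_with_degrees_def simple_graph_on_def)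
  show "(`) ((`) p) ` graphs_with_degrees V f \<subseteq> graphs_with_degrees W g"
    using image_graphs_with_degrees[of p V f g] inj fg W by auto
  show "(`) ((`) q) ` graphs_with_degrees W g \<subseteq> graphs_with_degrees V f"
    using image_graphs_with_degrees[of q W g f] injq gf V by auto
qed

text \<open>Finiteness matters: with infinitely many edges, \<open>degree\<close> may be 0 at a vertex that
  is not isolated.\<close>

lemma graphs_with_degrees_nonzero:
  assumes V: "finite V"
  shows "graphs_with_degrees {v \<in> V. f v \<noteq> 0} f = graphs_with_degrees V f"
proof (intro set_eqI iffI)
  fix E assume E: "E \<in> graphs_with_degrees V f"
  then have sg: "simple_graph_on V E" by (simp add: graphs_with_degrees_def)
  have "f v \<noteq> 0" if "e \<in> E" "v \<in> e" for e v
  proof -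
    have "degree E v \<noteq> 0"
      using that finite_simple_graph[OF V sg] by (auto simp: degree_def)
    moreover have "v \<in> V" using that sg by (auto simp: simple_graph_on_def)
    ultimately show ?thesis using E by (simp add: graphs_with_degrees_def)
  qed
  then show "E \<in> graphs_with_degrees {v \<in> V. f v \<noteq> 0} f"
    using E by (fastforce simp: graphs_with_degrees_def simple_graph_on_def)
next
  fix E assume E: "E \<in> graphs_with_degrees {v \<in> V. f v \<noteq> 0} f"
  have "degree E v = f v" if "v \<in> V" for v
  proof (cases "f v = 0")
    case True
    then have "{e \<in> E. v \<in> e} = {}"
      using E unfolding graphs_with_degrees_def simple_graph_on_def by blast
    then have "degree E v = 0" by (simp only: degree_def card.empty)
    then show ?thesis using True by simp
  next
    case False
    then show ?thesis using E that by (simp add: graphs_with_degrees_def)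
  qed
  then show "E \<in> graphs_with_degrees V f"
    using E by (auto simp: graphs_with_degrees_def simple_graph_on_def)
qed

section \<open>Degree sequences and degree functions\<close>

text \<open>Any listing of the degrees gives the same count: the permutation that matches the two lists
  is a bijection between the vertex sets.\<close>

lemma num_realizations_mset:
  assumes xs: "distinct xs" and e: "mset e = mset (map f xs)"
  shows "num_realizations e = card (graphs_with_degrees (set xs) f)"
proof -
  obtain p where p: "bij_betw p {..<length e} {..<length xs}"
    and nth: "\<forall>i<length e. e ! i = map f xs ! p i"
    using permutation_Ex_bij[OF e] by auto
  have "bij_betw ((!) xs \<circ> (p \<circ> (\<lambda>i. i - 1))) {1..length e} (set xs)"
  proof (intro bij_betw_trans)
    show "bij_betw (\<lambda>i. i - 1) {1..length e} {..<length e}"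
      by (rule bij_betw_byWitness[where f' = Suc]) auto
    show "bij_betw p {..<length e} {..<length xs}" by (rule p)
    show "bij_betw ((!) xs) {..<length xs} (set xs)"
      by (rule bij_betw_nth[OF xs]) auto
  qed
  moreover have "e ! (i - 1) = f (((!) xs \<circ> (p \<circ> (\<lambda>i. i - 1))) i)" if "i \<in> {1..length e}" for i
  proof -
    have "i - 1 < length e" using that by auto
    moreover from this have "p (i - 1) < length xs" using bij_betwE[OF p] by auto
    ultimately show ?thesis using nth by simp
  qed
  ultimately show ?thesis
    unfolding num_realizations_eq by (rule card_graphs_with_degrees_bij)
qed

lemma num_realizations_reduce_seq:
  "num_realizations (reduce_seq d S) =
    card (graphs_with_degrees {1..length d} (\<lambda>i. d ! (i - 1) - (if i \<in> S then 1 else 0)))"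
proof -
  let ?g = "\<lambda>i. d ! (i - 1) - (if i \<in> S then 1 else 0)"
  let ?xs = "filter (\<lambda>i. ?g i \<noteq> 0) [1..<length d + 1]"
  have "mset (reduce_seq d S) = mset (filter (\<lambda>x. x \<noteq> 0) (map ?g [1..<length d + 1]))"
    unfolding reduce_seq_def by (simp only: mset_filter mset_rev mset_sort)
  also have "\<dots> = mset (map ?g ?xs)" by (simp only: filter_map comp_def)
  finally have "num_realizations (reduce_seq d S) = card (graphs_with_degrees (set ?xs) ?g)"
    by (rule num_realizations_mset[rotated]) simp
  also have "set ?xs = {i \<in> {1..length d}. ?g i \<noteq> 0}" by auto
  finally show ?thesis by (simp only: graphs_with_degrees_nonzero[OF finite_atLeastAtMost])
qed

section \<open>Deleting a vertex\<close>

definition star :: "'v \<Rightarrow> 'v set \<Rightarrow> 'v set set" where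
  "star x S = (\<lambda>v. {x, v}) ` S"

lemma star_edges_at:
  assumes "x \<notin> S" "v \<noteq> x"
  shows "{e \<in> star x S. v \<in> e} = (if v \<in> S then {{x, v}} else {})"
  using assms by (auto simp: star_def)

lemma degree_union_star_center:
  assumes "\<forall>e\<in>F. x \<notin> e"
  shows "degree (F \<union> star x S) x = card S"
proof -
  have "{e \<in> F \<union> star x S. x \<in> e} = star x S" using assms by (auto simp: star_def)
  moreover have "inj_on (\<lambda>v. {x, v}) S" by (auto simp: inj_on_def doubleton_eq_iff)
  ultimately show ?thesis by (simp add: degree_def star_def card_image)
qed

lemma degree_union_star:
  assumes F: "finite F" "\<forall>e\<in>F. x \<notin> e" and S: "x \<notin> S" and v: "v \<noteq> x"
  shows "degree (F \<union> star x S) v = degree F v + (if v \<in> S then 1 else 0)"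
proof -
  have "{e \<in> F \<union> star x S. v \<in> e} = {e \<in> F. v \<in> e} \<union> {e \<in> star x S. v \<in> e}" by auto
  also have "\<dots> = {e \<in> F. v \<in> e} \<union> (if v \<in> S then {{x, v}} else {})"
    by (simp only: star_edges_at[OF S v])
  finally have at: "{e \<in> F \<union> star x S. v \<in> e} =
    {e \<in> F. v \<in> e} \<union> (if v \<in> S then {{x, v}} else {})" .
  have new: "{x, v} \<notin> {e \<in> F. v \<in> e}" using F(2) by blast
  show ?thesis
    unfolding degree_def at using F(1) new by (cases "v \<in> S") (simp_all del: mem_Collect_eq)
qed

text \<open>An edge at \<open>x\<close> has a second endpoint, so it is determined by it.\<close>

lemma simple_graph_split_star:
  assumes "simple_graph_on V E"
  shows "E = {e \<in> E. x \<notin> e} \<union> star x {v. {x, v} \<in> E}"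
proof -
  have "\<exists>v. e = {x, v}" if "e \<in> E" "x \<in> e" for e
    using assms that by (fastforce simp: simple_graph_on_def card_2_iff)
  then show ?thesis by (auto simp: star_def)
qed

text \<open>Vertex deletion. The inverse of \<open>(S, F) \<mapsto> F \<union> star x S\<close> reads off the neighbourhood of \<open>x\<close>
  and the edges that avoid \<open>x\<close>. As subtraction is truncated, \<open>f\<close> has to be positive:
  otherwise the sum would also count sets \<open>S\<close> that contain a vertex of prescribed degree 0.\<close>

lemma card_graphs_with_degrees_insert:
  assumes V: "finite V" and x: "x \<notin> V" and f: "\<And>v. v \<in> V \<Longrightarrow> f v > 0"
  shows "card (graphs_with_degrees (insert x V) f) =
    (\<Sum>S | S \<subseteq> V \<and> card S = f x.
      card (graphs_with_degrees V (\<lambda>v. f v - (if v \<in> S then 1 else 0))))"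
proof -
  let ?A = "{S. S \<subseteq> V \<and> card S = f x}"
  let ?B = "\<lambda>S. graphs_with_degrees V (\<lambda>v. f v - (if v \<in> S then 1 else 0))"
  have "bij_betw (\<lambda>(S, F). F \<union> star x S) (SIGMA S:?A. ?B S) (graphs_with_degrees (insert x V) f)"
  proof (rule bij_betw_byWitness[where f' = "\<lambda>E. ({v. {x, v} \<in> E}, {e \<in> E. x \<notin> e})"])
    show "\<forall>E\<in>graphs_with_degrees (insert x V) f.
        (case ({v. {x, v} \<in> E}, {e \<in> E. x \<notin> e}) of (S, F) \<Rightarrow> F \<union> star x S) = E"
      using simple_graph_split_star by (fastforce simp: graphs_with_degrees_def)
    show "\<forall>a\<in>(SIGMA S:?A. ?B S). ({v. {x, v} \<in> (case a of (S, F) \<Rightarrow> F \<union> star x S)},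
        {e \<in> (case a of (S, F) \<Rightarrow> F \<union> star x S). x \<notin> e}) = a"
      using x by (auto simp: graphs_with_degrees_def simple_graph_on_def star_def doubleton_eq_iff)
    show "(\<lambda>(S, F). F \<union> star x S) ` (SIGMA S:?A. ?B S) \<subseteq> graphs_with_degrees (insert x V) f"
    proof clarify
      fix S F assume S: "S \<subseteq> V" "card S = f x" and F: "F \<in> ?B S"
      have sg: "simple_graph_on V F" using F by (simp add: graphs_with_degrees_def)
      then have xF: "\<forall>e\<in>F. x \<notin> e" using x by (auto simp: simple_graph_on_def)
      have xS: "x \<notin> S" using x S by auto
      have "simple_graph_on (insert x V) (F \<union> star x S)"
        using sg S xS by (auto simp: simple_graph_on_def star_def card_2_iff)
      moreover have "degree (F \<union> star x S) v = f v" if "v \<in> V" for v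
      proof -
        have "v \<noteq> x" using that x by auto
        then show ?thesis
          using degree_union_star[OF finite_simple_graph[OF V sg] xF xS] F f[OF that] that
          by (simp add: graphs_with_degrees_def)
      qed
      ultimately show "F \<union> star x S \<in> graphs_with_degrees (insert x V) f"
        using degree_union_star_center[OF xF] S by (simp add: graphs_with_degrees_def)
    qed
    show "(\<lambda>E. ({v. {x, v} \<in> E}, {e \<in> E. x \<notin> e})) ` graphs_with_degrees (insert x V) f
        \<subseteq> (SIGMA S:?A. ?B S)"
    proof (rule image_subsetI)
      fix E assume E: "E \<in> graphs_with_degrees (insert x V) f"
      let ?S = "{v. {x, v} \<in> E}" and ?F = "{e \<in> E. x \<notin> e}"
      have sg: "simple_graph_on (insert x V) E" using E by (simp add: graphs_with_degrees_def)
      have split: "E = ?F \<union> star x ?S" by (rule simple_graph_split_star[OF sg])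
      have fin: "finite ?F" using finite_simple_graph[OF _ sg] V by simp
      \<comment> \<open>The vertex \<open>x\<close> is not its own neighbour, as \<open>{x, x}\<close> has only one element.\<close>
      have xS: "x \<notin> ?S" using sg by (auto simp: simple_graph_on_def)
      then have "?S \<subseteq> V" using sg by (fastforce simp: simple_graph_on_def)
      moreover have "card ?S = f x"
        using degree_union_star_center[of ?F x ?S] E
        by (simp add: split[symmetric] graphs_with_degrees_def)
      moreover have "simple_graph_on V ?F" using sg by (auto simp: simple_graph_on_def)
      moreover have "degree ?F v = f v - (if v \<in> ?S then 1 else 0)" if "v \<in> V" for v
      proof -
        have "v \<noteq> x" using that x by auto
        then have "degree E v = degree ?F v + (if v \<in> ?S then 1 else 0)"
          using degree_union_star[OF fin _ xS] by (simp add: split[symmetric])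
        then show ?thesis using E that by (simp add: graphs_with_degrees_def)
      qed
      ultimately show "(?S, ?F) \<in> (SIGMA S:?A. ?B S)"
        by (simp add: graphs_with_degrees_def)
    qed
  qed
  then have "card (graphs_with_degrees (insert x V) f) = card (SIGMA S:?A. ?B S)"
    by (rule bij_betw_same_card[symmetric])
  also have "\<dots> = (\<Sum>S\<in>?A. card (?B S))"
    using V by (intro card_SigmaI) (auto intro: finite_graphs_with_degrees)
  finally show ?thesis .
qed

section \<open>The recurrence\<close>

theorem theorem1p1:
  fixes n :: nat and d :: "nat list"
  assumes "n > 1"
    and "length d = n"
    and "sorted_wrt (\<ge>) d"
    and "\<forall>x\<in>set d. x > 0"
    and "even (sum_list d)"
  shows "num_realizations d =
    (\<Sum>S\<in>{S. S \<subseteq> {1..n - 1} \<and> card S = last d}. num_realizations (reduce_seq (butlast d) S))"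
proof -
  let ?f = "\<lambda>i. d ! (i - 1)"
  have V: "{1..length d} = insert n {1..n - 1}" using assms(1,2) by auto
  have last: "?f n = last d" using assms(1,2) by (subst last_conv_nth) auto
  have "num_realizations d = card (graphs_with_degrees (insert n {1..n - 1}) ?f)"
    by (simp only: num_realizations_eq V)
  also have "\<dots> = (\<Sum>S | S \<subseteq> {1..n - 1} \<and> card S = ?f n.
      card (graphs_with_degrees {1..n - 1} (\<lambda>i. ?f i - (if i \<in> S then 1 else 0))))"
  proof (rule card_graphs_with_degrees_insert)
    show "n \<notin> {1..n - 1}" using assms(1) by simp
    show "?f i > 0" if "i \<in> {1..n - 1}" for i
    proof -
      have "i - 1 < length d" using that assms(2) by auto
      then show ?thesis using assms(4) nth_mem by blast
    qed
  qed simp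
  also have "\<dots> = (\<Sum>S | S \<subseteq> {1..n - 1} \<and> card S = last d.
      num_realizations (reduce_seq (butlast d) S))"
  proof (rule sum.cong)
    fix S
    have "graphs_with_degrees {1..n - 1} (\<lambda>i. ?f i - (if i \<in> S then 1 else 0)) =
        graphs_with_degrees {1..n - 1} (\<lambda>i. butlast d ! (i - 1) - (if i \<in> S then 1 else 0))"
      using assms(2) by (intro graphs_with_degrees_cong) (auto simp: nth_butlast)
    then show "card (graphs_with_degrees {1..n - 1} (\<lambda>i. ?f i - (if i \<in> S then 1 else 0))) =
        num_realizations (reduce_seq (butlast d) S)"
      using assms(2) by (simp add: num_realizations_reduce_seq)
  qed (simp only: last)
  finally show ?thesis .
qed

end
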